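(* Let $\mathcal{S}=(S,+,\cdot,0,1)$ be a commutative idempotent simple completely distributive semiring. Then there exist binary operations $\wedge$ and $\rightarrow$ on $S$ such that $(S,+,\wedge,\cdot,\rightarrow,0,1)$ is a residuated lattice (with $+$ as join and $\cdot$ as the monoid operation).
   Context: A semiring is an algebra $(S,+,\cdot,0,1)$ of type $(2,2,0,0)$ such that $(S,+,0)$ is a commutative monoid, $(S,\cdot,1)$ is a monoid, $(x+y)\cdot z=x\cdot z+y\cdot z$ and $x\cdot(y+z)=x\cdot y+x\cdot z$, and $x\cdot 0=0\cdot x=0$, for all $x,y,z\in S$. It is called idempotent if $x+x=x$ for all $x$, commutative if $x\cdot y=y\cdot x$ for all $x,y$, and simple if $x+1=1$ for all $x$. If the semiring is idempotent, $(S,+)$ is a join-semilattice with induced order $a\leq b$ iff $a+b=b$, and $\sum_{i\in I}x_i$ denotes the supremum of the family $(x_i)_{i\in I}$ with respect to $\leq$ (if it exists). A commutative idempotent semiring is called completely distributive if (i) $\sum_{i\in I}y_i$ exists for all sets $I$ and all $y_i\in S$ ($i\in I$), and (ii) $x\cdot\bigl(\sum_{i\in I}y_i\bigr)=\sum_{i\in I}(x\cdot y_i)$ for all sets $I$ and all $x,y_i\in S$ ($i\in I$). A residuated lattice is an algebra $(L,\vee,\wedge,\odot,\rightarrow,0,1)$ of type $(2,2,2,2,0,0)$ such that $(L,\vee,\wedge,0,1)$ is a bounded lattice (with least element $0$ and greatest element $1$), $(L,\odot,1)$ is a commutative monoid, and for all $x,y,z\in L$: $x\odot y\leq z$ if and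 only if $x\leq y\rightarrow z$, where $\leq$ is the lattice order. *)

theory Defs
  imports "HOL-Algebra.Ring" "HOL-Algebra.Lattice"
begin

text \<open>
  Semirings are those of \<^locale>\<open>semiring\<close> in HOL-Algebra, whose axioms do not exclude
  \<open>\<zero> = \<one>\<close>; commutativity of the multiplication is \<^locale>\<open>comm_monoid\<close>.
\<close>

locale idempotent_semiring = semiring S for S (structure) +
  assumes add_idem: "x \<in> carrier S \<Longrightarrow> x \<oplus> x = x"

locale simple_semiring = semiring S for S (structure) +
  assumes add_one: "x \<in> carrier S \<Longrightarrow> x \<oplus> \<one> = \<one>"

locale comm_idempotent_semiring = idempotent_semiring S + comm_monoid S for S (structure)

definition induced_order :: "('a, 'm) ring_scheme \<Rightarrow> 'a gorder" where
  "induced_order S = \<lparr>carrier = carrier S, eq = (=), le = (\<lambda>a b. a \<oplus>\<^bsub>S\<^esub> b = b)\<rparr>"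

text \<open>
  The index sets of the families below are sets of elements of the carrier type, because a
  definition cannot quantify over types. This is no restriction, since a supremum depends only
  on the range of the family; see \<open>sup_exists_any_index\<close> and \<open>mult_sup_any_index\<close>.
  The term \<^term>\<open>supr L I y\<close> is specified only when the supremum exists, which
  \<open>sup_exists\<close> guarantees for both sides of \<open>mult_sup\<close>.
\<close>

locale completely_distributive_semiring = comm_idempotent_semiring S
  for S :: "('a, 'm) ring_scheme" (structure) +
  assumes sup_exists:
    "\<And>(I :: 'a set) y. y \<in> I \<rightarrow> carrier S \<Longrightarrow>
       \<exists>s. least (induced_order S) s (Upper (induced_order S) (y ` I))"
  and mult_sup:
    "\<And>x (I :: 'a set) y. x \<in> carrier S \<Longrightarrow> y \<in> I \<rightarrow> carrier S \<Longrightarrow>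
       x \<otimes> supr (induced_order S) I y = supr (induced_order S) I (\<lambda>i. x \<otimes> y i)"
begin

lemma sup_exists_any_index:
  fixes I :: "'i set"
  assumes "y \<in> I \<rightarrow> carrier S"
  shows "\<exists>s. least (induced_order S) s (Upper (induced_order S) (y ` I))"
  using sup_exists[of "\<lambda>a. a" "y ` I"] assms by auto

lemma mult_sup_any_index:
  fixes I :: "'i set"
  assumes "x \<in> carrier S" "y \<in> I \<rightarrow> carrier S"
  shows "x \<otimes> supr (induced_order S) I y = supr (induced_order S) I (\<lambda>i. x \<otimes> y i)"
  using mult_sup[of x "\<lambda>a. a" "y ` I"] assms by (auto simp: supr_def image_image)

end

locale residuated_lattice =
  fixes L :: "'a set"
    and join :: "'a \<Rightarrow> 'a \<Rightarrow> 'a" (infixl \<open>\<squnion>\<close> 65)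
    and meet :: "'a \<Rightarrow> 'a \<Rightarrow> 'a" (infixl \<open>\<sqinter>\<close> 70)
    and prod :: "'a \<Rightarrow> 'a \<Rightarrow> 'a" (infixl \<open>\<odot>\<close> 70)
    and imp :: "'a \<Rightarrow> 'a \<Rightarrow> 'a" (infixr \<open>\<rightharpoonup>\<close> 60)
    and bot :: 'a
    and top :: 'a
  assumes join_closed: "x \<in> L \<Longrightarrow> y \<in> L \<Longrightarrow> x \<squnion> y \<in> L"
    and meet_closed: "x \<in> L \<Longrightarrow> y \<in> L \<Longrightarrow> x \<sqinter> y \<in> L"
    and imp_closed: "x \<in> L \<Longrightarrow> y \<in> L \<Longrightarrow> x \<rightharpoonup> y \<in> L"
    and bot_closed: "bot \<in> L"
    and join_assoc: "x \<in> L \<Longrightarrow> y \<in> L \<Longrightarrow> z \<in> L \<Longrightarrow> (x \<squnion> y) \<squnion> z = x \<squnion> (y \<squnion> z)"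
    and join_comm: "x \<in> L \<Longrightarrow> y \<in> L \<Longrightarrow> x \<squnion> y = y \<squnion> x"
    and meet_assoc: "x \<in> L \<Longrightarrow> y \<in> L \<Longrightarrow> z \<in> L \<Longrightarrow> (x \<sqinter> y) \<sqinter> z = x \<sqinter> (y \<sqinter> z)"
    and meet_comm: "x \<in> L \<Longrightarrow> y \<in> L \<Longrightarrow> x \<sqinter> y = y \<sqinter> x"
    and join_meet_absorb: "x \<in> L \<Longrightarrow> y \<in> L \<Longrightarrow> x \<squnion> (x \<sqinter> y) = x"
    and meet_join_absorb: "x \<in> L \<Longrightarrow> y \<in> L \<Longrightarrow> x \<sqinter> (x \<squnion> y) = x"
    and bot_least: "x \<in> L \<Longrightarrow> bot \<squnion> x = x"
    and top_greatest: "x \<in> L \<Longrightarrow> x \<squnion> top = top"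
    and prod_comm_monoid: "comm_monoid \<lparr>carrier = L, mult = (\<odot>), one = top\<rparr>"
    \<comment> \<open>adjointness, with \<open>a \<le> b\<close> written out as \<open>a \<squnion> b = b\<close>\<close>
    and residuation: "x \<in> L \<Longrightarrow> y \<in> L \<Longrightarrow> z \<in> L \<Longrightarrow>
      (x \<odot> y) \<squnion> z = z \<longleftrightarrow> x \<squnion> (y \<rightharpoonup> z) = y \<rightharpoonup> z"

end

theory Submission
  imports Defs
begin

text \<open>
  Meets and residua are suprema: \<open>x \<sqinter> y\<close> is the supremum of the common lower bounds of \<open>x\<close> and
  \<open>y\<close>, and \<open>y \<rightharpoonup> z\<close> is the supremum of all \<open>x\<close> with \<open>x \<otimes> y \<le> z\<close>. Distributivity of the product
  over suprema says that this last supremum is itself a solution of \<open>x \<otimes> y \<le> z\<close>, which is the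
  nontrivial half of adjointness; simplicity makes \<open>\<one>\<close> the greatest element.
\<close>

context idempotent_semiring
begin

text \<open>The relation \<open>le\<close> of \<open>induced_order S\<close>, unfolded to the
  equation in which the target locale states adjointness.\<close>

definition below :: "'a \<Rightarrow> 'a \<Rightarrow> bool" (infix \<open>\<preceq>\<close> 50) where
  "a \<preceq> b \<longleftrightarrow> a \<oplus> b = b"

lemma below_refl: "a \<in> carrier S \<Longrightarrow> a \<preceq> a"
  by (simp add: below_def add_idem)

lemma below_antisym: "a \<in> carrier S \<Longrightarrow> b \<in> carrier S \<Longrightarrow> a \<preceq> b \<Longrightarrow> b \<preceq> a \<Longrightarrow> a = b"
  unfolding below_def using a_comm[of a b] by simp

lemma below_trans:
  "a \<in> carrier S \<Longrightarrow> b \<in> carrier S \<Longrightarrow> c \<in> carrier S \<Longrightarrow> a \<preceq> b \<Longrightarrow> b \<preceq> c \<Longrightarrow> a \<preceq> c"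
  unfolding below_def using a_assoc[of a b c] by simp

lemma below_add: "a \<in> carrier S \<Longrightarrow> b \<in> carrier S \<Longrightarrow> a \<preceq> a \<oplus> b"
  unfolding below_def using a_assoc[of a a b] add_idem[of a] by simp

lemma mult_right_mono:
  "a \<in> carrier S \<Longrightarrow> b \<in> carrier S \<Longrightarrow> c \<in> carrier S \<Longrightarrow> a \<preceq> b \<Longrightarrow> a \<otimes> c \<preceq> b \<otimes> c"
  unfolding below_def using l_distr[of a b c] by simp

end

context completely_distributive_semiring
begin

abbreviation Lub :: "'a set \<Rightarrow> 'a" where
  "Lub A \<equiv> Lattice.sup (induced_order S) A"

text \<open>\<open>Lattice.sup\<close> is a Hilbert choice, so it is a least upper bound as soon as
  one exists; \<open>sup_exists\<close> yields one for the identity family on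
  \<open>A\<close>.\<close>

lemma least_Lub:
  assumes "A \<subseteq> carrier S"
  shows "least (induced_order S) (Lub A) (Upper (induced_order S) A)"
proof -
  have "\<exists>s. least (induced_order S) s (Upper (induced_order S) A)"
    using sup_exists[of "\<lambda>a. a" A] assms by auto
  then show ?thesis
    unfolding Lattice.sup_def by (rule someI_ex)
qed

lemma Lub_closed: "A \<subseteq> carrier S \<Longrightarrow> Lub A \<in> carrier S"
  using least_Lub[of A] by (auto simp: least_def Upper_def induced_order_def)

lemma Lub_upper: "A \<subseteq> carrier S \<Longrightarrow> a \<in> A \<Longrightarrow> a \<preceq> Lub A"
  using least_Lub[of A] by (auto simp: least_def Upper_def induced_order_def below_def)

lemma Lub_least:
  "A \<subseteq> carrier S \<Longrightarrow> z \<in> carrier S \<Longrightarrow> (\<And>a. a \<in> A \<Longrightarrow> a \<preceq> z) \<Longrightarrow> Lub A \<preceq> z"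
  using least_Lub[of A] by (auto simp: least_def Upper_def induced_order_def below_def)

lemma mult_Lub:
  "x \<in> carrier S \<Longrightarrow> A \<subseteq> carrier S \<Longrightarrow> x \<otimes> Lub A = Lub ((\<lambda>a. x \<otimes> a) ` A)"
  using mult_sup[of x "\<lambda>a. a" A] by (auto simp: supr_def)

definition Meet :: "'a \<Rightarrow> 'a \<Rightarrow> 'a" where
  "Meet x y = Lub {w \<in> carrier S. w \<preceq> x \<and> w \<preceq> y}"

lemma Meet_closed: "Meet x y \<in> carrier S"
  unfolding Meet_def by (rule Lub_closed) auto

text \<open>Both \<open>x\<close> and \<open>y\<close> bound the set of common lower bounds from
  above, so its supremum is again a common lower bound.\<close>

lemma below_Meet_iff:
  assumes "x \<in> carrier S" "y \<in> carrier S" "w \<in> carrier S"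
  shows "w \<preceq> Meet x y \<longleftrightarrow> w \<preceq> x \<and> w \<preceq> y"
proof -
  have "Meet x y \<preceq> x" "Meet x y \<preceq> y"
    unfolding Meet_def using assms by (auto intro!: Lub_least)
  moreover have "w \<preceq> Meet x y" if "w \<preceq> x" "w \<preceq> y"
    unfolding Meet_def using assms that by (auto intro!: Lub_upper)
  ultimately show ?thesis
    using assms Meet_closed below_trans[of w "Meet x y" x] below_trans[of w "Meet x y" y] by auto
qed

text \<open>An element is determined by the elements below it: the equivalence is used at
  \<open>m\<close> and at \<open>Meet x y\<close>, then antisymmetry applies. Meet identities thus
  reduce to comparing lower bounds.\<close>

lemma Meet_eqI:
  assumes "x \<in> carrier S" "y \<in> carrier S" "m \<in> carrier S"
    and "\<And>w. w \<in> carrier S \<Longrightarrow> w \<preceq> m \<longleftrightarrow> w \<preceq> x \<and> w \<preceq> y"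
  shows "Meet x y = m"
proof (rule below_antisym)
  show "Meet x y \<preceq> m" "m \<preceq> Meet x y"
    using assms below_Meet_iff[of x y] below_refl[of m] below_refl[of "Meet x y"]
    by (auto simp: Meet_closed)
qed (use assms Meet_closed in auto)

lemma Meet_assoc:
  assumes "x \<in> carrier S" "y \<in> carrier S" "z \<in> carrier S"
  shows "Meet (Meet x y) z = Meet x (Meet y z)"
  using assms by (intro Meet_eqI) (auto simp: Meet_closed below_Meet_iff)

lemma Meet_comm: "Meet x y = Meet y x"
  by (simp add: Meet_def conj.commute)

lemma add_Meet_absorb:
  assumes "x \<in> carrier S" "y \<in> carrier S"
  shows "x \<oplus> Meet x y = x"
  using assms below_Meet_iff[of x y "Meet x y"] below_refl[of "Meet x y"] a_comm[of x "Meet x y"]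
  by (simp add: Meet_closed below_def)

lemma Meet_add_absorb:
  assumes "x \<in> carrier S" "y \<in> carrier S"
  shows "Meet x (x \<oplus> y) = x"
proof (rule Meet_eqI)
  fix w assume "w \<in> carrier S"
  \<comment> \<open>Since \<open>x \<preceq> x \<oplus> y\<close>, every lower bound of
    \<open>x\<close> is also one of \<open>x \<oplus> y\<close>.\<close>
  then show "w \<preceq> x \<longleftrightarrow> w \<preceq> x \<and> w \<preceq> x \<oplus> y"
    using assms below_trans[of w x "x \<oplus> y"] below_add by auto
qed (use assms in auto)

definition Residuum :: "'a \<Rightarrow> 'a \<Rightarrow> 'a" where
  "Residuum y z = Lub {x \<in> carrier S. x \<otimes> y \<preceq> z}"

lemma Residuum_closed: "Residuum y z \<in> carrier S"
  unfolding Residuum_def by (rule Lub_closed) auto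

lemma Residuum_mult_below:
  assumes "y \<in> carrier S" "z \<in> carrier S"
  shows "Residuum y z \<otimes> y \<preceq> z"
proof -
  let ?A = "{x \<in> carrier S. x \<otimes> y \<preceq> z}"
  \<comment> \<open>Distributivity over suprema is available for a left factor, hence the
    commutation.\<close>
  have "Residuum y z \<otimes> y = y \<otimes> Lub ?A"
    using assms Residuum_closed m_comm by (simp add: Residuum_def)
  also have "\<dots> = Lub ((\<lambda>a. y \<otimes> a) ` ?A)"
    using assms by (intro mult_Lub) auto
  also have "\<dots> \<preceq> z"
    using assms by (intro Lub_least) (auto simp: m_comm)
  finally show ?thesis .
qed

text \<open>From left to right, \<open>x\<close> is a member of the set whose supremum is taken.
  Conversely, multiplying by \<open>y\<close> is monotone and \<open>Residuum y z\<close> is itself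
  a solution.\<close>

lemma mult_below_iff_below_Residuum:
  assumes "x \<in> carrier S" "y \<in> carrier S" "z \<in> carrier S"
  shows "x \<otimes> y \<preceq> z \<longleftrightarrow> x \<preceq> Residuum y z"
proof
  assume "x \<otimes> y \<preceq> z"
  then show "x \<preceq> Residuum y z"
    unfolding Residuum_def using assms by (auto intro!: Lub_upper)
next
  assume "x \<preceq> Residuum y z"
  then have "x \<otimes> y \<preceq> Residuum y z \<otimes> y"
    using assms Residuum_closed by (intro mult_right_mono)
  then show "x \<otimes> y \<preceq> z"
    using assms Residuum_closed Residuum_mult_below
      below_trans[of "x \<otimes> y" "Residuum y z \<otimes> y" z] by auto
qed

end

theorem theorem8:
  fixes S :: "('a, 'm) ring_scheme" (structure)
  assumes "completely_distributive_semiring S"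
    and "simple_semiring S"
  shows "\<exists>meet imp. residuated_lattice (carrier S) (\<oplus>) meet (\<otimes>) imp \<zero> \<one>"
proof -
  interpret completely_distributive_semiring S by fact
  interpret simple_semiring S by fact
  \<comment> \<open>The target locale asks for a bare monoid record, so the laws are transferred
    from \<open>S\<close> to its multiplicative part.\<close>
  have "comm_monoid \<lparr>carrier = carrier S, mult = (\<otimes>), one = \<one>\<rparr>"
    by (rule comm_monoidI) (auto simp: m_assoc intro: m_comm)
  then have "residuated_lattice (carrier S) (\<oplus>) Meet (\<otimes>) Residuum \<zero> \<one>"
  proof (intro residuated_lattice.intro)
    fix x y z
    assume "x \<in> carrier S" "y \<in> carrier S" "z \<in> carrier S"
    then show "x \<otimes> y \<oplus> z = z \<longleftrightarrow> x \<oplus> Residuum y z = Residuum y z"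
      using mult_below_iff_below_Residuum by (simp add: below_def)
  qed (auto simp: Meet_closed Residuum_closed a_assoc Meet_assoc add_Meet_absorb
      Meet_add_absorb add_one intro: a_comm Meet_comm)
  then show ?thesis by blast
qed

end
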